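(* Let $\alpha \in \{0\} \cup [1,\infty)$ and let $M \in \mathcal{B}(\ell^2)$ be the generalized Cesàro matrix of order two, i.e. the operator on $\ell^2$ given by the lower triangular matrix $M = [m_{ij}]_{i,j\ge 0}$ with $m_{ij} = \frac{2(i+1-j)}{(i+1+\alpha)(i+2+\alpha)}$ for $0 \le j \le i$ and $m_{ij} = 0$ for $j > i$. Then $M$ is hyponormal.
   Context: $\ell^2$ is the Hilbert space of square-summable sequences indexed by $\{0,1,2,\dots\}$, and matrices act with respect to its standard orthonormal basis; $\mathcal{B}(\ell^2)$ denotes the bounded linear operators on $\ell^2$. The matrix $M$ is a bounded operator on $\ell^2$ for every real $\alpha > -1$. An operator $A \in \mathcal{B}(\ell^2)$ is hyponormal if $\langle (A^*A - AA^* )f, f\rangle \geq 0$ for all $f \in \ell^2$. *)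

theory Defs
  imports "HOL-Analysis.Analysis" "HOL-Library.Complex_Order"
begin

text \<open>
  The complex Hilbert space of square-summable sequences indexed by \<open>0, 1, 2, \<dots>\<close> is represented by
  a carrier set of functions. An operator is a map on all sequences, of which only
  the restriction to this carrier is relevant.
\<close>

definition ell2 :: "(nat \<Rightarrow> complex) set" where
  "ell2 = {f. summable (\<lambda>n. (cmod (f n))\<^sup>2)}"

definition ell2_inner :: "(nat \<Rightarrow> complex) \<Rightarrow> (nat \<Rightarrow> complex) \<Rightarrow> complex" where
  "ell2_inner f g = (\<Sum>n. f n * cnj (g n))"

definition ell2_norm :: "(nat \<Rightarrow> complex) \<Rightarrow> real" where
  "ell2_norm f = sqrt (\<Sum>n. (cmod (f n))\<^sup>2)"

definition bounded_ops :: "((nat \<Rightarrow> complex) \<Rightarrow> (nat \<Rightarrow> complex)) set" where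
  "bounded_ops = {A.
     (\<forall>f\<in>ell2. A f \<in> ell2) \<and>
     (\<forall>f\<in>ell2. \<forall>g\<in>ell2. A (\<lambda>n. f n + g n) = (\<lambda>n. A f n + A g n)) \<and>
     (\<forall>c. \<forall>f\<in>ell2. A (\<lambda>n. c * f n) = (\<lambda>n. c * A f n)) \<and>
     (\<exists>K. \<forall>f\<in>ell2. ell2_norm (A f) \<le> K * ell2_norm f)}"

text \<open>
  The description is proper for bounded operators and arguments \<open>g\<close> in \<open>ell2\<close>, where
  existence and uniqueness of \<open>h\<close> are given by the Riesz representation theorem.
\<close>

definition ell2_adjoint ::
    "((nat \<Rightarrow> complex) \<Rightarrow> (nat \<Rightarrow> complex)) \<Rightarrow> (nat \<Rightarrow> complex) \<Rightarrow> (nat \<Rightarrow> complex)" where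
  "ell2_adjoint A g = (THE h. h \<in> ell2 \<and> (\<forall>f\<in>ell2. ell2_inner (A f) g = ell2_inner f h))"

text \<open>
  Boundedness is part of hyponormality. The order on complex numbers is that of
  \<^theory>\<open>HOL-Library.Complex_Order\<close>: \<open>0 \<le> z\<close> means that \<open>z\<close> is real and nonnegative.
\<close>

definition hyponormal :: "((nat \<Rightarrow> complex) \<Rightarrow> (nat \<Rightarrow> complex)) \<Rightarrow> bool" where
  "hyponormal A \<longleftrightarrow> A \<in> bounded_ops \<and>
     (\<forall>f\<in>ell2. 0 \<le> ell2_inner (\<lambda>n. ell2_adjoint A (A f) n - A (ell2_adjoint A f) n) f)"

definition matrix_op ::
    "(nat \<Rightarrow> nat \<Rightarrow> complex) \<Rightarrow> (nat \<Rightarrow> complex) \<Rightarrow> (nat \<Rightarrow> complex)" where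
  "matrix_op m f = (\<lambda>i. \<Sum>j. m i j * f j)"

definition cesaro2 :: "real \<Rightarrow> nat \<Rightarrow> nat \<Rightarrow> complex" where
  "cesaro2 \<alpha> i j =
     (if j \<le> i
      then complex_of_real
             (2 * (real i + 1 - real j) / ((real i + 1 + \<alpha>) * (real i + 2 + \<alpha>)))
      else 0)"

end

theory Submission
  imports Defs
begin

text \<open>
  Write \<open>d\<^sub>i = 2 / ((i + 1 + \<alpha>) (i + 2 + \<alpha>))\<close>, so that \<open>m\<^sub>i\<^sub>j = d\<^sub>i (i + 1 - j)\<close>. For the diagonal matrix
  \<open>P\<close> with entries \<open>p\<^sub>n = x (x + 1) / ((x + 2) (x + 3)) \<le> 1\<close>, \<open>x = n + 1 + \<alpha>\<close>, the entries of
  \<open>M\<^sup>* P M\<close> can be summed in closed form, and \<open>M\<^sup>* P M - M M\<^sup>*\<close> turns out to have rank two: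
  \<open>M\<^sup>* P M - M M\<^sup>* = \<alpha> u u\<^sup>* + (\<alpha> (\<alpha>\<^sup>2 - 1) / 12) d d\<^sup>*\<close> with \<open>u\<^sub>i = d\<^sub>i (i + (3 + \<alpha>) / 2)\<close>.
  The right-hand side is positive for \<open>\<alpha> = 0\<close> and for \<open>\<alpha> \<ge> 1\<close>, and \<open>M\<^sup>* P M \<le> M\<^sup>* M\<close>.

  For a truncated input the identity holds up to a remainder bounded by a multiple of
  \<open>n A\<^sub>n\<^sup>2\<close>, where \<open>A\<^sub>n\<close> are the Cesaro means of \<open>|f|\<close>. By Hardy's inequality \<open>\<Sum> A\<^sub>n\<^sup>2\<close> converges,
  so \<open>n A\<^sub>n\<^sup>2\<close> is small for infinitely many \<open>n\<close> because the harmonic series diverges. Hardy's inequality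
  also shows that \<open>M\<close> is bounded.
\<close>

subsection \<open>The quadratic form of a truncated sequence\<close>

definition ces_weight :: "real \<Rightarrow> nat \<Rightarrow> real" where
  "ces_weight \<alpha> i = 2 / ((real i + 1 + \<alpha>) * (real i + 2 + \<alpha>))"

definition ces :: "real \<Rightarrow> nat \<Rightarrow> nat \<Rightarrow> real" where
  "ces \<alpha> i j = (if j \<le> i then ces_weight \<alpha> i * (real i + 1 - real j) else 0)"

lemma cesaro2_eq: "cesaro2 \<alpha> i j = of_real (ces \<alpha> i j)"
  by (simp add: cesaro2_def ces_def ces_weight_def)

lemma sum_arith: "(\<Sum>k\<le>i. z - real k) = (real i + 1) * (2 * z - real i) / 2"
  by (induction i) (auto simp: field_simps)

text \<open>For \<open>z = n + 1\<close> and \<open>i \<le> n\<close> this is, up to the weights,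
  the inner product of rows \<open>i\<close> and \<open>n\<close> of \<open>M\<close>, hence an
  entry of \<open>M M\<^sup>*\<close>.\<close>

lemma sum_arith_product:
  "(\<Sum>k\<le>i. (real i + 1 - real k) * (z - real k)) = (real i + 1) * (real i + 2) * (3 * z - real i) / 6"
proof (induction i)
  case 0
  show ?case by simp
next
  case (Suc i)
  \<comment> \<open>Raising \<open>i\<close> adds one \<open>z - k\<close> to every summand; the old
    summand at \<open>k = Suc i\<close> is zero.\<close>
  have "(\<Sum>k\<le>Suc i. (real (Suc i) + 1 - real k) * (z - real k)) =
      (\<Sum>k\<le>Suc i. (real i + 1 - real k) * (z - real k)) + (\<Sum>k\<le>Suc i. z - real k)"
    by (simp add: sum.distrib[symmetric] algebra_simps)
  also have "(\<Sum>k\<le>Suc i. (real i + 1 - real k) * (z - real k)) =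
      (real i + 1) * (real i + 2) * (3 * z - real i) / 6"
    using Suc by simp
  finally show ?case
    unfolding sum_arith by (simp add: field_simps)
qed

text \<open>
  The closed form of \<open>\<Sum>m. ces_damped \<alpha> (n + m) * (t + (m + 1) * s)\<^sup>2\<close>: the damped energy still to
  come when the input is zero from index \<open>n\<close> on.
\<close>

definition ces_remainder :: "real \<Rightarrow> nat \<Rightarrow> real \<Rightarrow> real \<Rightarrow> real" where
  "ces_remainder \<alpha> n t s = (let x = real n + 1 + \<alpha> in
     4 / (3 * x * (x + 1) * (x + 2)) * t\<^sup>2 + 4 / (3 * x * (x + 1)) * t * s
       + 2 * (2 * x + 1) / (3 * x * (x + 1)) * s\<^sup>2)"

text \<open>
  This is \<open>d\<^sub>n\<^sup>2 p\<^sub>n\<close> for the damping factor \<open>p\<^sub>n = x (x + 1) / ((x + 2) (x + 3)) \<le> 1\<close>, chosen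
  because products of consecutive factors telescope under summation.
\<close>

definition ces_damped :: "real \<Rightarrow> nat \<Rightarrow> real" where
  "ces_damped \<alpha> n = (let x = real n + 1 + \<alpha> in 4 / (x * (x + 1) * (x + 2) * (x + 3)))"

text \<open>A zero input takes the state \<open>(t, s)\<close> to \<open>(t + s, s)\<close>. The
  facts 1, 2, 3 compare the coefficients of \<open>t\<^sup>2\<close>, \<open>t * s\<close> and
  \<open>s\<^sup>2\<close>.\<close>

lemma ces_remainder_step:
  assumes "\<alpha> \<ge> 0"
  shows "ces_damped \<alpha> n * (t + s)\<^sup>2 + ces_remainder \<alpha> (Suc n) (t + s) s = ces_remainder \<alpha> n t s"
proof -
  define x where "x = real n + 1 + \<alpha>"
  have x: "x > 0" using assms by (simp add: x_def)
  have x1: "real (Suc n) + 1 + \<alpha> = x + 1" by (simp add: x_def)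
  have nz: "x \<noteq> 0" "x + 1 \<noteq> 0" "x + 2 \<noteq> 0" "x + 3 \<noteq> 0" using x by auto
  have 1: "4 / (x * (x + 1) * (x + 2) * (x + 3)) + 4 / (3 * (x + 1) * (x + 2) * (x + 3))
     = 4 / (3 * x * (x + 1) * (x + 2))"
    using nz by (simp add: divide_simps) algebra
  have 2: "8 / (x * (x + 1) * (x + 2) * (x + 3)) + 8 / (3 * (x + 1) * (x + 2) * (x + 3))
      + 4 / (3 * (x + 1) * (x + 2)) = 4 / (3 * x * (x + 1))"
    using nz by (simp add: divide_simps) algebra
  have 3: "4 / (x * (x + 1) * (x + 2) * (x + 3)) + 4 / (3 * (x + 1) * (x + 2) * (x + 3))
      + 4 / (3 * (x + 1) * (x + 2)) + 2 * (2 * (x + 1) + 1) / (3 * (x + 1) * (x + 2))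
     = 2 * (2 * x + 1) / (3 * x * (x + 1))"
    using nz by (simp add: divide_simps) algebra
  have e: "x + 1 + 1 = x + 2" "x + 1 + 2 = x + 3" by auto
  show ?thesis
    unfolding ces_damped_def ces_remainder_def Let_def x1 x_def[symmetric] e
      1[symmetric] 2[symmetric] 3[symmetric]
    by (simp add: power2_eq_square) (simp add: algebra_simps add_divide_distrib)
qed

text \<open>\<open>T\<close> is the double partial sum of \<open>f\<close>, so
  \<open>ces_weight \<alpha> k * T (Suc k)\<close> is entry \<open>k\<close> of \<open>M f\<close>.
  For \<open>f\<close> cut off at \<open>n\<close>, the left-hand side is the form of
  \<open>M M\<^sup>*\<close> plus the rank-two terms and the right-hand side is the form of
  \<open>M\<^sup>* P M\<close>, with the remainder standing for the rows from \<open>n\<close> on.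
  In the induction, \<open>cross\<close> and \<open>diag\<close> match the terms linear and
  quadratic in the new entry \<open>f n\<close>.\<close>

lemma ces_energy:
  fixes f :: "nat \<Rightarrow> real"
  assumes \<alpha>: "\<alpha> \<ge> 0"
  defines "S \<equiv> \<lambda>n. \<Sum>i<n. f i"
  defines "T \<equiv> \<lambda>n. \<Sum>i<n. (real n - real i) * f i"
  shows "(\<Sum>k<n. (\<Sum>i<n. ces \<alpha> i k * f i)\<^sup>2)
      + \<alpha> * (\<Sum>i<n. ces_weight \<alpha> i * (real i + (3 + \<alpha>) / 2) * f i)\<^sup>2
      + \<alpha> * (\<alpha>\<^sup>2 - 1) / 12 * (\<Sum>i<n. ces_weight \<alpha> i * f i)\<^sup>2
    = (\<Sum>k<n. ces_damped \<alpha> k * (T (Suc k))\<^sup>2) + ces_remainder \<alpha> n (T n) (S n)"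
proof (induction n)
  case 0
  show ?case by (simp add: S_def T_def ces_remainder_def)
next
  case (Suc n)
  define d where "d = ces_weight \<alpha>"
  define h where "h k = (\<Sum>i<n. ces \<alpha> i k * f i)" for k
  define u where "u = (\<Sum>i<n. d i * (real i + (3 + \<alpha>) / 2) * f i)"
  define w where "w = (\<Sum>i<n. d i * f i)"
  define c where "c = (\<Sum>k<Suc n. h k * (real n + 1 - real k))"
  define x where "x = real n + 1 + \<alpha>"
  have x: "x > 0" using \<alpha> by (simp add: x_def)
  have dn: "d n = 2 / (x * (x + 1))" by (simp add: d_def ces_weight_def x_def add.commute add.left_commute)
  have TS: "T (Suc n) = T n + S (Suc n)"
    by (simp add: T_def S_def sum.distrib[symmetric] algebra_simps)
  have SS: "S (Suc n) = S n + f n" by (simp add: S_def)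
  \<comment> \<open>Column \<open>n\<close> meets only the new row, so the old sum over
    \<open>k < n\<close> extends to \<open>k < Suc n\<close>.\<close>
  have hn: "h n = 0" by (simp add: h_def ces_def)
  have "(\<Sum>k<Suc n. (\<Sum>i<Suc n. ces \<alpha> i k * f i)\<^sup>2)
      = (\<Sum>k<Suc n. (h k + d n * f n * (real n + 1 - real k))\<^sup>2)"
    by (intro sum.cong) (auto simp: h_def ces_def d_def mult_ac)
  also have "\<dots> = (\<Sum>k<Suc n. (h k)\<^sup>2 + 2 * d n * f n * (h k * (real n + 1 - real k))
       + (d n * f n)\<^sup>2 * ((real n + 1 - real k) * (real n + 1 - real k)))"
    by (intro sum.cong) (auto simp: power2_eq_square algebra_simps)
  also have "\<dots> = (\<Sum>k<n. (h k)\<^sup>2) + 2 * d n * f n * c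
       + (d n * f n)\<^sup>2 * (\<Sum>k\<le>n. (real n + 1 - real k) * (real n + 1 - real k))"
    unfolding c_def lessThan_Suc_atMost[symmetric] sum_distrib_left sum.distrib by (simp add: hn)
  also have "\<dots> = (\<Sum>k<n. (h k)\<^sup>2) + 2 * d n * f n * c
       + (d n * f n)\<^sup>2 * ((real n + 1) * (real n + 2) * (2 * real n + 3) / 6)"
    unfolding sum_arith_product by (simp add: algebra_simps)
  finally have H: "(\<Sum>k<Suc n. (\<Sum>i<Suc n. ces \<alpha> i k * f i)\<^sup>2) = \<dots>" .
  have inner: "(\<Sum>k<Suc n. ces \<alpha> i k * (real n + 1 - real k)) =
      d i * ((real i + 1) * (real i + 2) * (3 * (real n + 1) - real i) / 6)" if "i < n" for i
  proof -
    have "(\<Sum>k<Suc n. ces \<alpha> i k * (real n + 1 - real k)) =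
       (\<Sum>k\<le>i. d i * ((real i + 1 - real k) * (real n + 1 - real k)))"
      by (rule sum.mono_neutral_cong_right) (use that in \<open>auto simp: ces_def d_def\<close>)
    then show ?thesis
      unfolding sum_distrib_left[symmetric] sum_arith_product by simp
  qed
  \<comment> \<open>The kernel of the damped form minus that of \<open>M M\<^sup>*\<close> has rank two; for \<open>i \<le> n\<close>, divided by
    \<open>d\<^sub>n\<close>, this reads:\<close>
  have ker: "d i * ((real i + 1) * (real i + 2) * (3 * (real n + 1) - real i) / 6)
      + \<alpha> * (real n + (3 + \<alpha>) / 2) * (d i * (real i + (3 + \<alpha>) / 2)) + \<alpha> * (\<alpha>\<^sup>2 - 1) / 12 * d i
      = (real n - real i) / 3 + (2 * x + 1) / 3" for i
  proof -
    have nz: "real i + 1 + \<alpha> \<noteq> 0" "real i + 2 + \<alpha> \<noteq> 0" using \<alpha> by auto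
    show ?thesis unfolding d_def ces_weight_def x_def using nz
      by (simp add: divide_simps) algebra
  qed
  have "c = (\<Sum>k<Suc n. \<Sum>i<n. f i * (ces \<alpha> i k * (real n + 1 - real k)))"
    unfolding c_def h_def sum_distrib_right by (simp add: mult_ac)
  also have "\<dots> = (\<Sum>i<n. f i * (\<Sum>k<Suc n. ces \<alpha> i k * (real n + 1 - real k)))"
    unfolding sum_distrib_left by (rule sum.swap)
  also have "\<dots> = (\<Sum>i<n. f i * (d i * ((real i + 1) * (real i + 2) * (3 * (real n + 1) - real i) / 6)))"
    by (intro sum.cong refl arg_cong2[of _ _ _ _ "(*)"] inner) auto
  finally have c: "c = \<dots>" .
  have "c + \<alpha> * (real n + (3 + \<alpha>) / 2) * u + \<alpha> * (\<alpha>\<^sup>2 - 1) / 12 * w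
     = (\<Sum>i<n. f i * (d i * ((real i + 1) * (real i + 2) * (3 * (real n + 1) - real i) / 6)
      + \<alpha> * (real n + (3 + \<alpha>) / 2) * (d i * (real i + (3 + \<alpha>) / 2)) + \<alpha> * (\<alpha>\<^sup>2 - 1) / 12 * d i))"
    unfolding c u_def w_def sum_distrib_left sum.distrib[symmetric]
    by (intro sum.cong refl) (simp add: field_simps)
  also have "\<dots> = T n / 3 + (2 * x + 1) / 3 * S n"
    unfolding ker T_def S_def
    by (simp add: sum_distrib_left sum_divide_distrib sum.distrib[symmetric] algebra_simps)
  finally have cross: "c = T n / 3 + (2 * x + 1) / 3 * S n
     - \<alpha> * (real n + (3 + \<alpha>) / 2) * u - \<alpha> * (\<alpha>\<^sup>2 - 1) / 12 * w"
    by simp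
  \<comment> \<open>The case \<open>i = n\<close> of \<open>ker\<close>, multiplied by
    \<open>d n\<close>.\<close>
  have diag: "(d n)\<^sup>2 * ((real n + 1) * (real n + 2) * (2 * real n + 3) / 6)
      + \<alpha> * (d n * (real n + (3 + \<alpha>) / 2))\<^sup>2 + \<alpha> * (\<alpha>\<^sup>2 - 1) / 12 * (d n)\<^sup>2 = d n * (2 * x + 1) / 3"
    using ker[of n] by (simp add: power2_eq_square) algebra
  \<comment> \<open>The update has two stages: the new entry first changes \<open>s\<close> with
    \<open>t\<close> and the index fixed, then \<open>ces_remainder_step\<close> advances the
    index.\<close>
  have B: "ces_remainder \<alpha> n (T n) (S (Suc n)) = ces_remainder \<alpha> n (T n) (S n)
      + 2 * d n * f n * (T n / 3 + (2 * x + 1) / 3 * S n) + (f n)\<^sup>2 * (d n * (2 * x + 1) / 3)"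
    unfolding ces_remainder_def Let_def x_def[symmetric] SS dn using x
    by (simp add: power2_eq_square) (simp add: algebra_simps add_divide_distrib)
  have "(\<Sum>k<Suc n. ces_damped \<alpha> k * (T (Suc k))\<^sup>2) + ces_remainder \<alpha> (Suc n) (T (Suc n)) (S (Suc n))
     = (\<Sum>k<n. ces_damped \<alpha> k * (T (Suc k))\<^sup>2) + ces_remainder \<alpha> n (T n) (S (Suc n))"
    using ces_remainder_step[OF \<alpha>, of n "T n" "S (Suc n)"] TS by simp
  also have "\<dots> = (\<Sum>k<n. (h k)\<^sup>2) + \<alpha> * u\<^sup>2 + \<alpha> * (\<alpha>\<^sup>2 - 1) / 12 * w\<^sup>2
      + 2 * d n * f n * (T n / 3 + (2 * x + 1) / 3 * S n) + (f n)\<^sup>2 * (d n * (2 * x + 1) / 3)"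
    unfolding B using Suc by (simp add: h_def u_def w_def d_def)
  also have "\<dots> = ((\<Sum>k<n. (h k)\<^sup>2) + 2 * d n * f n * c
       + (d n * f n)\<^sup>2 * ((real n + 1) * (real n + 2) * (2 * real n + 3) / 6))
       + \<alpha> * (u + d n * (real n + (3 + \<alpha>) / 2) * f n)\<^sup>2
       + \<alpha> * (\<alpha>\<^sup>2 - 1) / 12 * (w + d n * f n)\<^sup>2"
    unfolding cross diag[symmetric] by (simp add: power2_eq_square) (simp add: algebra_simps add_divide_distrib diff_divide_distrib)
  finally show ?case
    unfolding H by (simp add: u_def w_def d_def)
qed

subsection \<open>Hardy's inequality and the remainder\<close>

lemma hardy_inequality:
  fixes a :: "nat \<Rightarrow> real"
  shows "(\<Sum>n<N. ((\<Sum>i\<le>n. a i) / (real n + 1))\<^sup>2) \<le> 4 * (\<Sum>n<N. (a n)\<^sup>2)"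
proof -
  define A where "A n = (\<Sum>i<n. a i) / real n" for n
  have A: "real n * A n = (\<Sum>i<n. a i)" for n
    by (cases "n = 0") (auto simp: A_def)
  \<comment> \<open>The boundary term \<open>real N * (A N)\<^sup>2\<close> strengthens the claim
    enough for induction.\<close>
  have "(\<Sum>n<N. (A (Suc n))\<^sup>2) + real N * (A N)\<^sup>2 \<le> (\<Sum>n<N. 2 * A (Suc n) * a n)"
  proof (induction N)
    case (Suc N)
    have a: "a N = real (Suc N) * A (Suc N) - real N * A N"
      unfolding A by simp
    \<comment> \<open>AM-GM makes the left-hand side telescope.\<close>
    have "real N * (2 * A (Suc N) * A N) \<le> real N * ((A (Suc N))\<^sup>2 + (A N)\<^sup>2)"
      using sum_squares_bound[of "A (Suc N)" "A N"] by (intro mult_left_mono) auto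
    then have "(A (Suc N))\<^sup>2 + real (Suc N) * (A (Suc N))\<^sup>2 - real N * (A N)\<^sup>2
        \<le> 2 * A (Suc N) * a N"
      unfolding a by (simp add: power2_eq_square algebra_simps)
    then show ?case using Suc by simp
  qed simp
  \<comment> \<open>The weights are chosen so that half of the left-hand side absorbs the first
    term, which yields the constant 4.\<close>
  also have "\<dots> \<le> (\<Sum>n<N. (A (Suc n))\<^sup>2 / 2 + 2 * (a n)\<^sup>2)"
  proof (rule sum_mono)
    fix n
    show "2 * A (Suc n) * a n \<le> (A (Suc n))\<^sup>2 / 2 + 2 * (a n)\<^sup>2"
      using sum_squares_bound[of "A (Suc n)" "2 * a n"] by (simp add: power2_eq_square)
  qed
  also have "\<dots> = (\<Sum>n<N. (A (Suc n))\<^sup>2) / 2 + 2 * (\<Sum>n<N. (a n)\<^sup>2)"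
    by (simp add: sum.distrib sum_divide_distrib sum_distrib_left)
  finally have "(\<Sum>n<N. (A (Suc n))\<^sup>2) / 2 + real N * (A N)\<^sup>2 \<le> 2 * (\<Sum>n<N. (a n)\<^sup>2)"
    by simp
  moreover have "real N * (A N)\<^sup>2 \<ge> 0" by simp
  ultimately have "(\<Sum>n<N. (A (Suc n))\<^sup>2) \<le> 4 * (\<Sum>n<N. (a n)\<^sup>2)" by linarith
  then show ?thesis by (simp add: A_def lessThan_Suc_atMost add.commute)
qed

lemma summable_hardy:
  fixes a :: "nat \<Rightarrow> real"
  assumes "summable (\<lambda>n. (a n)\<^sup>2)"
  shows "summable (\<lambda>n. ((\<Sum>i\<le>n. a i) / (real n + 1))\<^sup>2)"
    and "(\<Sum>n. ((\<Sum>i\<le>n. a i) / (real n + 1))\<^sup>2) \<le> 4 * (\<Sum>n. (a n)\<^sup>2)"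
proof -
  have *: "(\<Sum>n<N. ((\<Sum>i\<le>n. a i) / (real n + 1))\<^sup>2) \<le> 4 * (\<Sum>n. (a n)\<^sup>2)" for N
    using hardy_inequality[of a N] sum_le_suminf[OF assms, of "{..<N}"] by simp
  show "summable (\<lambda>n. ((\<Sum>i\<le>n. a i) / (real n + 1))\<^sup>2)"
    by (rule summableI_nonneg_bounded) (use * in auto)
  then show "(\<Sum>n. ((\<Sum>i\<le>n. a i) / (real n + 1))\<^sup>2) \<le> 4 * (\<Sum>n. (a n)\<^sup>2)"
    by (rule suminf_le_const) (use * in auto)
qed

text \<open>Otherwise \<open>c\<close> would dominate \<open>e / (n + 1)\<close> from
  \<open>N\<close> on. Summability does not force \<open>(n + 1) * c n\<close> to tend to zero, so
  only arbitrarily large indices are claimed.\<close>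

lemma summable_frequently_small:
  fixes c :: "nat \<Rightarrow> real"
  assumes "summable c" "e > 0"
  shows "\<exists>n\<ge>N. (real n + 1) * c n < e"
proof (rule ccontr)
  assume "\<not> ?thesis"
  then have *: "e \<le> (real n + 1) * c n" if "n \<ge> N" for n
    using that by force
  have "summable (\<lambda>n. inverse (of_nat (Suc n)) :: real)"
  proof (rule summable_comparison_test'[where N = N])
    show "summable (\<lambda>n. c n / e)" using assms(1) by (rule summable_divide)
    show "norm (inverse (of_nat (Suc n)) :: real) \<le> c n / e" if "n \<ge> N" for n
      using *[OF that] \<open>e > 0\<close> by (simp add: divide_simps mult_ac add.commute)
  qed
  then show False
    using not_summable_harmonic[where 'a = real] by (subst (asm) summable_Suc_iff) simp
qed

lemma ces_weight_nonneg: "\<alpha> \<ge> 0 \<Longrightarrow> 0 \<le> ces_weight \<alpha> n"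
  by (simp add: ces_weight_def)

lemma ces_nonneg: "\<alpha> \<ge> 0 \<Longrightarrow> 0 \<le> ces \<alpha> i j"
  by (simp add: ces_def ces_weight_nonneg)

lemma ces_le:
  assumes "\<alpha> \<ge> 0"
  shows "ces \<alpha> i j \<le> 2 / (real i + 1)"
proof (cases "j \<le> i")
  case True
  have "(real i + 1 - real j) * (real i + 1) \<le> (real i + 2 + \<alpha>) * (real i + 1 + \<alpha>)"
    using assms True by (intro mult_mono) auto
  then show ?thesis using True assms
    by (simp add: ces_def ces_weight_def divide_simps) (simp add: algebra_simps)
qed (simp add: ces_def)

lemma ces_damped_le:
  assumes "\<alpha> \<ge> 0"
  shows "ces_damped \<alpha> n \<le> (ces_weight \<alpha> n)\<^sup>2"
proof -
  define x where "x = real n + 1 + \<alpha>"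
  have x: "x > 0" using assms by (simp add: x_def)
  have "(ces_weight \<alpha> n)\<^sup>2 = 4 / (x * (x + 1) * (x * (x + 1)))"
    by (simp add: ces_weight_def x_def power2_eq_square algebra_simps)
  moreover have "x * (x + 1) * (x * (x + 1)) \<le> x * (x + 1) * ((x + 2) * (x + 3))"
    using x by (intro mult_mono) auto
  ultimately show ?thesis
    unfolding ces_damped_def Let_def x_def[symmetric] using x
    by (auto intro!: divide_left_mono simp: mult_ac)
qed

text \<open>With \<open>m = n + 1\<close>, the terms are of order \<open>t\<^sup>2 / m^3\<close>,
  \<open>t * s / m\<^sup>2\<close> and \<open>s\<^sup>2 / m\<close>, so each is at most a multiple
  of \<open>m * A\<^sup>2\<close>. The multiples 4/3, 4/3 and 2 add up to less than 5.\<close>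

lemma ces_remainder_le:
  assumes "\<alpha> \<ge> 0" "\<bar>s\<bar> \<le> real (Suc n) * A" "\<bar>t\<bar> \<le> (real (Suc n))\<^sup>2 * A"
  shows "ces_remainder \<alpha> (Suc n) t s \<le> 5 * ((real n + 1) * A\<^sup>2)"
proof -
  define m where "m = real (Suc n)"
  define x where "x = m + 1 + \<alpha>"
  have m: "m > 0" "m \<le> x" "m \<le> x + 1" "m \<le> x + 2" using assms by (auto simp: m_def x_def)
  have "0 \<le> real (Suc n) * A" using assms(2) abs_ge_zero order_trans by blast
  then have A: "A \<ge> 0" by (simp add: zero_le_mult_iff)
  have t2: "t\<^sup>2 \<le> (m\<^sup>2 * A)\<^sup>2" and s2: "s\<^sup>2 \<le> (m * A)\<^sup>2"
    using power_mono[OF assms(3), of 2] power_mono[OF assms(2), of 2] by (auto simp: m_def)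
  have ts: "t * s \<le> (m\<^sup>2 * A) * (m * A)"
    using mult_mono[OF assms(3,2)] A abs_le_D1[of "t * s"] by (simp add: m_def abs_mult)
  have "4 / (3 * x * (x + 1) * (x + 2)) * t\<^sup>2 \<le> 4 / (3 * m * m * m) * (m\<^sup>2 * A)\<^sup>2"
    using m t2 by (intro mult_mono divide_left_mono mult_nonneg_nonneg mult_pos_pos) auto
  also have "\<dots> = 4 / 3 * (m * A\<^sup>2)" using m by (simp add: power2_eq_square)
  finally have 1: "4 / (3 * x * (x + 1) * (x + 2)) * t\<^sup>2 \<le> 4 / 3 * (m * A\<^sup>2)" .
  have "4 / (3 * x * (x + 1)) * (t * s) \<le> 4 / (3 * x * (x + 1)) * ((m\<^sup>2 * A) * (m * A))"
    using m ts by (intro mult_left_mono) auto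
  also have "\<dots> \<le> 4 / (3 * m * m) * ((m\<^sup>2 * A) * (m * A))"
    using m A by (intro mult_right_mono divide_left_mono mult_mono mult_nonneg_nonneg mult_pos_pos) auto
  also have "\<dots> = 4 / 3 * (m * A\<^sup>2)" using m by (simp add: power2_eq_square)
  finally have 2: "4 / (3 * x * (x + 1)) * t * s \<le> 4 / 3 * (m * A\<^sup>2)" by (simp add: mult_ac)
  have "2 * (2 * x + 1) / (3 * x * (x + 1)) \<le> 2 / x"
    using m by (simp add: divide_simps)
  also have "\<dots> \<le> 2 / m" using m by (intro divide_left_mono) auto
  finally have "2 * (2 * x + 1) / (3 * x * (x + 1)) * s\<^sup>2 \<le> 2 / m * (m * A)\<^sup>2"
    using m s2 by (intro mult_mono) auto
  also have "\<dots> = 2 * (m * A\<^sup>2)" using m by (simp add: power2_eq_square)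
  finally have "ces_remainder \<alpha> (Suc n) t s \<le> (4/3 + 4/3 + 2) * (m * A\<^sup>2)"
    using 1 2 by (simp add: ces_remainder_def Let_def x_def m_def)
  also have "\<dots> \<le> 5 * (m * A\<^sup>2)" using m by (intro mult_right_mono) auto
  finally show ?thesis by (simp add: m_def add.commute)
qed

text \<open>
  The rank-two terms of \<open>ces_energy\<close> are dropped here; this is where \<open>\<alpha> = 0\<close> or \<open>\<alpha> \<ge> 1\<close> is needed,
  to make the coefficient \<open>\<alpha> (\<alpha>\<^sup>2 - 1)\<close> nonnegative.
\<close>

lemma ces_column_energy:
  fixes f :: "nat \<Rightarrow> real"
  assumes \<alpha>: "\<alpha> \<in> {0} \<union> {1..}" and A: "(\<Sum>i\<le>n. \<bar>f i\<bar>) \<le> (real n + 1) * A"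
  shows "(\<Sum>k\<le>n. (\<Sum>i\<le>n. ces \<alpha> i k * f i)\<^sup>2)
    \<le> (\<Sum>k\<le>n. (\<Sum>j\<le>k. ces \<alpha> k j * f j)\<^sup>2) + 5 * ((real n + 1) * A\<^sup>2)"
proof -
  have \<alpha>0: "\<alpha> \<ge> 0" using \<alpha> by auto
  have \<alpha>1: "\<alpha> * (\<alpha>\<^sup>2 - 1) / 12 \<ge> 0"
    using \<alpha> by (cases "\<alpha> = 0") (auto intro!: divide_nonneg_nonneg mult_nonneg_nonneg simp: one_le_power)
  define S where "S n = (\<Sum>i<n. f i)" for n
  define T where "T n = (\<Sum>i<n. (real n - real i) * f i)" for n
  have "\<bar>S (Suc n)\<bar> \<le> (\<Sum>i\<le>n. \<bar>f i\<bar>)"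
    unfolding S_def lessThan_Suc_atMost by (rule sum_abs)
  then have S: "\<bar>S (Suc n)\<bar> \<le> real (Suc n) * A" using A by (simp add: add.commute)
  have "\<bar>T (Suc n)\<bar> \<le> (\<Sum>i\<le>n. \<bar>(real (Suc n) - real i) * f i\<bar>)"
    unfolding T_def lessThan_Suc_atMost by (rule sum_abs)
  also have "\<dots> \<le> (\<Sum>i\<le>n. real (Suc n) * \<bar>f i\<bar>)"
    by (intro sum_mono) (auto simp: abs_mult intro!: mult_right_mono)
  also have "\<dots> \<le> real (Suc n) * (real (Suc n) * A)"
    unfolding sum_distrib_left[symmetric] using A by (intro mult_left_mono) (auto simp: add.commute)
  finally have T: "\<bar>T (Suc n)\<bar> \<le> (real (Suc n))\<^sup>2 * A" by (simp add: power2_eq_square)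
  \<comment> \<open>This is \<open>P \<le> 1\<close>, applied to entry \<open>k\<close> of
    \<open>M f\<close>.\<close>
  have damp: "ces_damped \<alpha> k * (T (Suc k))\<^sup>2 \<le> (\<Sum>j\<le>k. ces \<alpha> k j * f j)\<^sup>2" for k
  proof -
    have "(\<Sum>j\<le>k. ces \<alpha> k j * f j) = ces_weight \<alpha> k * T (Suc k)"
      unfolding T_def lessThan_Suc_atMost sum_distrib_left
      by (intro sum.cong) (auto simp: ces_def algebra_simps)
    then show ?thesis
      using ces_damped_le[OF \<alpha>0, of k] by (simp add: power_mult_distrib mult_right_mono)
  qed
  have "(\<Sum>k<Suc n. (\<Sum>i<Suc n. ces \<alpha> i k * f i)\<^sup>2)
      \<le> (\<Sum>k<Suc n. (\<Sum>i<Suc n. ces \<alpha> i k * f i)\<^sup>2)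
      + \<alpha> * (\<Sum>i<Suc n. ces_weight \<alpha> i * (real i + (3 + \<alpha>) / 2) * f i)\<^sup>2
      + \<alpha> * (\<alpha>\<^sup>2 - 1) / 12 * (\<Sum>i<Suc n. ces_weight \<alpha> i * f i)\<^sup>2"
    unfolding add.assoc
    by (intro le_add_same_cancel1[THEN iffD2] add_nonneg_nonneg mult_nonneg_nonneg \<alpha>0 \<alpha>1 zero_le_power2)
  also have "\<dots> = (\<Sum>k<Suc n. ces_damped \<alpha> k * (T (Suc k))\<^sup>2)
      + ces_remainder \<alpha> (Suc n) (T (Suc n)) (S (Suc n))"
    unfolding ces_energy[OF \<alpha>0] S_def T_def by simp
  also have "\<dots> \<le> (\<Sum>k<Suc n. (\<Sum>j\<le>k. ces \<alpha> k j * f j)\<^sup>2) + 5 * ((real n + 1) * A\<^sup>2)"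
    by (intro add_mono sum_mono damp ces_remainder_le \<alpha>0 S T)
  finally show ?thesis unfolding lessThan_Suc_atMost .
qed

subsection \<open>Operators on the sequence space\<close>

lemma mult_le_sum_squares: "x * y \<le> x\<^sup>2 + y\<^sup>2" for x y :: real
  using sum_squares_bound[of x y] zero_le_power2[of x] zero_le_power2[of y] by linarith

lemma ell2_summable_mult:
  assumes "f \<in> ell2" "g \<in> ell2"
  shows "summable (\<lambda>n. cmod (f n) * cmod (g n))"
proof (rule summable_comparison_test')
  show "summable (\<lambda>n. (cmod (f n))\<^sup>2 + (cmod (g n))\<^sup>2)"
    using assms by (auto simp: ell2_def intro: summable_add)
  show "norm (cmod (f n) * cmod (g n)) \<le> (cmod (f n))\<^sup>2 + (cmod (g n))\<^sup>2" for n
    by (simp add: mult_le_sum_squares)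
qed

lemma ell2_inner_sums:
  assumes "f \<in> ell2" "g \<in> ell2"
  shows "(\<lambda>n. f n * cnj (g n)) sums ell2_inner f g"
proof -
  have "summable (\<lambda>n. f n * cnj (g n))"
    by (rule summable_norm_cancel) (use ell2_summable_mult[OF assms] in \<open>simp add: norm_mult\<close>)
  then show ?thesis unfolding ell2_inner_def by (rule summable_sums)
qed

lemma ell2_inner_commute:
  assumes "f \<in> ell2" "g \<in> ell2"
  shows "cnj (ell2_inner f g) = ell2_inner g f"
proof -
  have "(\<lambda>n. cnj (f n * cnj (g n))) sums cnj (ell2_inner f g)"
    using ell2_inner_sums[OF assms] by (simp only: sums_cnj)
  then have "(\<lambda>n. g n * cnj (f n)) sums cnj (ell2_inner f g)" by (simp add: mult.commute)
  then show ?thesis using ell2_inner_sums[OF assms(2,1)] by (rule sums_unique2)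
qed

lemma ell2_inner_diff:
  assumes "f \<in> ell2" "g \<in> ell2" "h \<in> ell2"
  shows "ell2_inner (\<lambda>n. f n - g n) h = ell2_inner f h - ell2_inner g h"
  using sums_diff[OF ell2_inner_sums[OF assms(1,3)] ell2_inner_sums[OF assms(2,3)]]
  unfolding ell2_inner_def[of "\<lambda>n. f n - g n"] by (simp add: sums_iff left_diff_distrib)

lemma ell2_inner_self:
  assumes "f \<in> ell2"
  shows "ell2_inner f f = of_real (\<Sum>n. (cmod (f n))\<^sup>2)"
proof -
  have "(\<lambda>n. complex_of_real ((cmod (f n))\<^sup>2)) sums of_real (\<Sum>n. (cmod (f n))\<^sup>2)"
    using assms by (intro sums_of_real summable_sums) (simp add: ell2_def)
  then have "(\<lambda>n. f n * cnj (f n)) sums of_real (\<Sum>n. (cmod (f n))\<^sup>2)"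
    by (simp only: complex_norm_square)
  with ell2_inner_sums[OF assms assms] show ?thesis by (rule sums_unique2)
qed

text \<open>Testing against the standard basis vectors gives uniqueness, so an explicit candidate
  determines the value of \<open>THE\<close>.\<close>

lemma ell2_adjoint_eqI:
  assumes "h \<in> ell2" "\<And>f. f \<in> ell2 \<Longrightarrow> ell2_inner (A f) g = ell2_inner f h"
  shows "ell2_adjoint A g = h"
  unfolding ell2_adjoint_def
proof (rule the_equality)
  show "h \<in> ell2 \<and> (\<forall>f\<in>ell2. ell2_inner (A f) g = ell2_inner f h)" using assms by blast
next
  fix h' assume h': "h' \<in> ell2 \<and> (\<forall>f\<in>ell2. ell2_inner (A f) g = ell2_inner f h')"
  have single: "ell2_inner (\<lambda>i. if i = n then 1 else 0) k = cnj (k n)" for n k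
  proof -
    have "ell2_inner (\<lambda>i. if i = n then 1 else 0) k
        = (\<Sum>i\<in>{n}. (if i = n then 1 else 0) * cnj (k i))"
      unfolding ell2_inner_def by (rule suminf_finite) auto
    then show ?thesis by simp
  qed
  have "h' n = h n" for n
  proof -
    have "(\<lambda>i. if i = n then 1 else 0) \<in> ell2"
      unfolding ell2_def by (auto intro!: summable_finite[of "{n}"] split: if_splits)
    then have "ell2_inner (\<lambda>i. if i = n then 1 else 0) h'
        = ell2_inner (\<lambda>i. if i = n then 1 else 0) h"
      using h' assms(2) by metis
    then show ?thesis by (simp add: single)
  qed
  then show "h' = h" by blast
qed

text \<open>Moving operators across the inner product turns the form into the squared norm of
  \<open>A f\<close> minus that of \<open>B f\<close>, where \<open>B\<close> is an explicit
  candidate for the adjoint.\<close>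

lemma hyponormalI:
  assumes A: "A \<in> bounded_ops"
    and B: "\<And>g. g \<in> ell2 \<Longrightarrow> B g \<in> ell2"
    and adj: "\<And>f g. f \<in> ell2 \<Longrightarrow> g \<in> ell2 \<Longrightarrow> ell2_inner (A f) g = ell2_inner f (B g)"
    and le: "\<And>f. f \<in> ell2 \<Longrightarrow> (\<Sum>n. (cmod (B f n))\<^sup>2) \<le> (\<Sum>n. (cmod (A f n))\<^sup>2)"
  shows "hyponormal A"
  unfolding hyponormal_def
proof (intro conjI ballI A)
  fix f assume f: "f \<in> ell2"
  have Af: "A g \<in> ell2" if "g \<in> ell2" for g using A that by (auto simp: bounded_ops_def)
  have adjoint: "ell2_adjoint A g = B g" if "g \<in> ell2" for g
    using that B adj by (intro ell2_adjoint_eqI) auto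
  have "ell2_inner (\<lambda>n. ell2_adjoint A (A f) n - A (ell2_adjoint A f) n) f
      = ell2_inner (B (A f)) f - ell2_inner (A (B f)) f"
    using f Af B by (simp add: adjoint ell2_inner_diff)
  \<comment> \<open>The conjugate disappears at the end, since \<open>ell2_inner_self\<close> makes
    this value real.\<close>
  also have "ell2_inner (B (A f)) f = cnj (ell2_inner (A f) (A f))"
    using f Af B by (simp add: adj ell2_inner_commute)
  also have "ell2_inner (A (B f)) f = ell2_inner (B f) (B f)"
    using f B by (simp add: adj)
  finally show "0 \<le> ell2_inner (\<lambda>n. ell2_adjoint A (A f) n - A (ell2_adjoint A f) n) f"
    using f Af B le by (simp add: ell2_inner_self less_eq_complex_def)
qed

section \<open>Boundedness of the Cesaro operator and its energy estimate\<close>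

lemma matrix_op_cesaro2:
  "matrix_op (cesaro2 \<alpha>) f i = (\<Sum>j\<le>i. of_real (ces \<alpha> i j) * f j)"
  unfolding matrix_op_def cesaro2_eq by (rule suminf_finite) (auto simp: ces_def)

definition abs_mean :: "(nat \<Rightarrow> complex) \<Rightarrow> nat \<Rightarrow> real" where
  "abs_mean f n = (\<Sum>i\<le>n. cmod (f i)) / (real n + 1)"

lemma norm_matrix_op_cesaro2_le:
  assumes "\<alpha> \<ge> 0"
  shows "cmod (matrix_op (cesaro2 \<alpha>) f n) \<le> 2 * abs_mean f n"
proof -
  have "cmod (matrix_op (cesaro2 \<alpha>) f n) \<le> (\<Sum>j\<le>n. cmod (of_real (ces \<alpha> n j) * f j))"
    unfolding matrix_op_cesaro2 by (rule norm_sum)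
  also have "\<dots> \<le> (\<Sum>j\<le>n. 2 / (real n + 1) * cmod (f j))"
    unfolding norm_mult norm_of_real abs_of_nonneg[OF ces_nonneg[OF assms]]
    by (intro sum_mono mult_right_mono ces_le assms norm_ge_zero)
  also have "\<dots> = 2 * abs_mean f n"
    by (simp add: abs_mean_def sum_distrib_left sum_divide_distrib)
  finally show ?thesis .
qed

lemma summable_abs_mean:
  assumes "f \<in> ell2"
  shows "summable (\<lambda>n. (abs_mean f n)\<^sup>2)"
    and "(\<Sum>n. (abs_mean f n)\<^sup>2) \<le> 4 * (\<Sum>n. (cmod (f n))\<^sup>2)"
  using assms summable_hardy[of "\<lambda>n. cmod (f n)"] by (auto simp: ell2_def abs_mean_def)

text \<open>The norm bound 4 combines the factor 2 in the pointwise bound by the means with the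
  factor 2 of Hardy's inequality.\<close>

lemma matrix_op_cesaro2_bounded:
  assumes \<alpha>: "\<alpha> \<ge> 0"
  shows "matrix_op (cesaro2 \<alpha>) \<in> bounded_ops"
proof -
  let ?M = "matrix_op (cesaro2 \<alpha>)"
  have sq: "(cmod (?M f n))\<^sup>2 \<le> 4 * (abs_mean f n)\<^sup>2" for f n
    using power_mono[OF norm_matrix_op_cesaro2_le[OF \<alpha>], of f n 2] by (simp add: power_mult_distrib)
  have s4: "summable (\<lambda>n. 4 * (abs_mean f n)\<^sup>2)" if "f \<in> ell2" for f
    using summable_abs_mean[OF that] by (intro summable_mult)
  have M: "summable (\<lambda>n. (cmod (?M f n))\<^sup>2)" if "f \<in> ell2" for f
    by (rule summable_comparison_test'[OF s4[OF that], of 0]) (simp add: sq)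
  have "ell2_norm (?M f) \<le> 4 * ell2_norm f" if f: "f \<in> ell2" for f
  proof -
    have "(\<Sum>n. (cmod (?M f n))\<^sup>2) \<le> (\<Sum>n. 4 * (abs_mean f n)\<^sup>2)"
      by (rule suminf_le[OF sq M[OF f] s4[OF f]])
    also have "\<dots> \<le> 4 * (4 * (\<Sum>n. (cmod (f n))\<^sup>2))"
      using summable_abs_mean[OF f] by (simp add: suminf_mult)
    finally show ?thesis
      using real_sqrt_le_mono[of _ "16 * (\<Sum>n. (cmod (f n))\<^sup>2)"]
      by (simp add: ell2_norm_def real_sqrt_mult)
  qed
  moreover have "?M (\<lambda>n. f n + g n) = (\<lambda>n. ?M f n + ?M g n)" for f g
    by (rule ext) (simp add: matrix_op_cesaro2 distrib_left sum.distrib)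
  moreover have "?M (\<lambda>n. c * f n) = (\<lambda>n. c * ?M f n)" for c f
    by (rule ext) (simp add: matrix_op_cesaro2 sum_distrib_left mult_ac)
  ultimately show ?thesis
    unfolding bounded_ops_def using M by (auto simp: ell2_def)
qed

text \<open>The matrix is real, so the real and imaginary parts decouple. Both have means bounded by
  \<open>abs_mean f n\<close>, and their two remainders add up to the factor 10.\<close>

lemma ces_column_energy_complex:
  fixes f :: "nat \<Rightarrow> complex"
  assumes \<alpha>: "\<alpha> \<in> {0} \<union> {1..}"
  shows "(\<Sum>k\<le>n. (cmod (\<Sum>i\<le>n. of_real (ces \<alpha> i k) * f i))\<^sup>2)
    \<le> (\<Sum>k\<le>n. (cmod (matrix_op (cesaro2 \<alpha>) f k))\<^sup>2) + 10 * ((real n + 1) * (abs_mean f n)\<^sup>2)"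
proof -
  have A: "(\<Sum>i\<le>n. cmod (f i)) = (real n + 1) * abs_mean f n"
    by (simp add: abs_mean_def add_pos_nonneg)
  have "(\<Sum>i\<le>n. \<bar>Re (f i)\<bar>) \<le> (real n + 1) * abs_mean f n"
    unfolding A[symmetric] by (intro sum_mono abs_Re_le_cmod)
  note 1 = ces_column_energy[OF \<alpha> this]
  have "(\<Sum>i\<le>n. \<bar>Im (f i)\<bar>) \<le> (real n + 1) * abs_mean f n"
    unfolding A[symmetric] by (intro sum_mono abs_Im_le_cmod)
  note 2 = ces_column_energy[OF \<alpha> this]
  show ?thesis
    using add_mono[OF 1 2] by (simp add: matrix_op_cesaro2 cmod_power2 sum.distrib)
qed

section \<open>The transposed matrix as the adjoint\<close>

definition ces_transpose :: "real \<Rightarrow> (nat \<Rightarrow> complex) \<Rightarrow> nat \<Rightarrow> complex" where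
  "ces_transpose \<alpha> f k = (\<Sum>i. of_real (ces \<alpha> i k) * f i)"

text \<open>By \<open>ces_le\<close> every column is bounded by the square-summable sequence
  \<open>2 / (i + 1)\<close>.\<close>

lemma summable_ces_column:
  assumes "\<alpha> \<ge> 0" "f \<in> ell2"
  shows "summable (\<lambda>i. ces \<alpha> i k * cmod (f i))"
proof (rule summable_comparison_test')
  have "summable (\<lambda>i. inverse ((real (Suc i))\<^sup>2))"
    using inverse_power_summable[of 2, where 'a = real] by (subst summable_Suc_iff) auto
  then show "summable (\<lambda>i. 4 * inverse ((real (Suc i))\<^sup>2) + (cmod (f i))\<^sup>2)"
    using assms(2) by (intro summable_add summable_mult) (auto simp: ell2_def)
  show "norm (ces \<alpha> i k * cmod (f i)) \<le> 4 * inverse ((real (Suc i))\<^sup>2) + (cmod (f i))\<^sup>2" for i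
  proof -
    have "norm (ces \<alpha> i k * cmod (f i)) \<le> 2 / (real i + 1) * cmod (f i)"
      unfolding real_norm_def abs_mult abs_norm_cancel abs_of_nonneg[OF ces_nonneg[OF assms(1)]]
      by (intro mult_right_mono ces_le assms norm_ge_zero)
    also have "\<dots> \<le> (2 / (real i + 1))\<^sup>2 + (cmod (f i))\<^sup>2"
      by (rule mult_le_sum_squares)
    also have "(2 / (real i + 1))\<^sup>2 = 4 * inverse ((real (Suc i))\<^sup>2)"
      by (simp add: power_divide field_simps)
    finally show ?thesis .
  qed
qed

lemma ces_transpose_LIMSEQ:
  assumes "\<alpha> \<ge> 0" "f \<in> ell2"
  shows "(\<lambda>n. \<Sum>i\<le>n. of_real (ces \<alpha> i k) * f i) \<longlonglongrightarrow> ces_transpose \<alpha> f k"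
proof -
  have "summable (\<lambda>i. of_real (ces \<alpha> i k) * f i)"
    by (rule summable_norm_cancel)
      (use summable_ces_column[OF assms] ces_nonneg[OF assms(1)] in \<open>simp add: norm_mult\<close>)
  then show ?thesis unfolding ces_transpose_def by (rule summable_LIMSEQ')
qed

text \<open>With \<open>K\<close> fixed, only finitely many truncated columns have to converge. The
  bound is uniform in \<open>K\<close>, so it yields both membership in \<open>ell2\<close> and the
  norm inequality behind hyponormality.\<close>

lemma ces_transpose_partial_sum_le:
  assumes \<alpha>: "\<alpha> \<in> {0} \<union> {1..}" and f: "f \<in> ell2"
  shows "(\<Sum>k<K. (cmod (ces_transpose \<alpha> f k))\<^sup>2) \<le> (\<Sum>n. (cmod (matrix_op (cesaro2 \<alpha>) f n))\<^sup>2)"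
proof (rule field_le_epsilon)
  fix e :: real assume e: "e > 0"
  let ?Mf = "matrix_op (cesaro2 \<alpha>) f"
  have \<alpha>0: "\<alpha> \<ge> 0" using \<alpha> by auto
  have Mf: "summable (\<lambda>n. (cmod (?Mf n))\<^sup>2)"
    using matrix_op_cesaro2_bounded[OF \<alpha>0] f by (auto simp: bounded_ops_def ell2_def)
  define h where "h n k = (\<Sum>i\<le>n. of_real (ces \<alpha> i k) * f i)" for n k
  have "(\<lambda>n. \<Sum>k<K. (cmod (h n k))\<^sup>2) \<longlonglongrightarrow> (\<Sum>k<K. (cmod (ces_transpose \<alpha> f k))\<^sup>2)"
    unfolding h_def by (intro tendsto_intros ces_transpose_LIMSEQ \<alpha>0 f)
  then have "eventually (\<lambda>n. (\<Sum>k<K. (cmod (ces_transpose \<alpha> f k))\<^sup>2) - e / 2 < (\<Sum>k<K. (cmod (h n k))\<^sup>2))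
      sequentially"
    using e by (intro order_tendstoD(1)) auto
  then obtain N where N: "\<And>n. n \<ge> N \<Longrightarrow>
      (\<Sum>k<K. (cmod (ces_transpose \<alpha> f k))\<^sup>2) - e / 2 < (\<Sum>k<K. (cmod (h n k))\<^sup>2)"
    by (auto simp: eventually_sequentially)
  \<comment> \<open>Ten times \<open>e / 20\<close> uses up one half of \<open>e\<close>; the other
    half covers the distance to the limit. One such \<open>n\<close> beyond \<open>N\<close> and
    \<open>K\<close> suffices.\<close>
  obtain n where n: "n \<ge> max N K" "(real n + 1) * (abs_mean f n)\<^sup>2 < e / 20"
    using summable_frequently_small[OF summable_abs_mean(1)[OF f], of "e / 20" "max N K"] e by auto
  have "(\<Sum>k<K. (cmod (h n k))\<^sup>2) \<le> (\<Sum>k\<le>n. (cmod (h n k))\<^sup>2)"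
    using n by (intro sum_mono2) auto
  also have "\<dots> \<le> (\<Sum>k\<le>n. (cmod (?Mf k))\<^sup>2) + 10 * ((real n + 1) * (abs_mean f n)\<^sup>2)"
    unfolding h_def by (rule ces_column_energy_complex[OF \<alpha>])
  also have "(\<Sum>k\<le>n. (cmod (?Mf k))\<^sup>2) \<le> (\<Sum>n. (cmod (?Mf n))\<^sup>2)"
    by (rule sum_le_suminf[OF Mf]) auto
  finally show "(\<Sum>k<K. (cmod (ces_transpose \<alpha> f k))\<^sup>2) \<le> (\<Sum>n. (cmod (?Mf n))\<^sup>2) + e"
    using N[of n] n by simp
qed

lemma ces_transpose_in_ell2:
  assumes "\<alpha> \<in> {0} \<union> {1..}" "f \<in> ell2"
  shows "ces_transpose \<alpha> f \<in> ell2"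
  unfolding ell2_def mem_Collect_eq
  by (rule summableI_nonneg_bounded[OF _ ces_transpose_partial_sum_le[OF assms]]) simp

text \<open>The double sum is truncated to \<open>i, j \<le> n\<close>, where its order can be
  exchanged. Tannery's theorem justifies the limit.\<close>

lemma ces_transpose_adjoint:
  assumes \<alpha>: "\<alpha> \<in> {0} \<union> {1..}" and f: "f \<in> ell2" and g: "g \<in> ell2"
  shows "ell2_inner (matrix_op (cesaro2 \<alpha>) f) g = ell2_inner f (ces_transpose \<alpha> g)"
proof -
  let ?M = "matrix_op (cesaro2 \<alpha>)"
  have \<alpha>0: "\<alpha> \<ge> 0" using \<alpha> by auto
  have Mf: "?M f \<in> ell2"
    using matrix_op_cesaro2_bounded[OF \<alpha>0] f by (auto simp: bounded_ops_def)
  define h where "h n j = (\<Sum>i\<le>n. of_real (ces \<alpha> i j) * g i)" for n j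
  \<comment> \<open>Replacing \<open>g\<close> by its modulus stays in \<open>ell2\<close>, and the
    transpose applied to \<open>G\<close> dominates all truncations \<open>h n\<close> at once; it
    is in \<open>ell2\<close>, so its product with \<open>f\<close> is summable.\<close>
  define G where "G = (\<lambda>i. complex_of_real (cmod (g i)))"
  have G: "G \<in> ell2" using g by (simp add: G_def ell2_def)
  have h_le: "cmod (h n j) \<le> cmod (ces_transpose \<alpha> G j)" for n j
  proof -
    have s: "summable (\<lambda>i. ces \<alpha> i j * cmod (g i))" by (rule summable_ces_column[OF \<alpha>0 g])
    have "cmod (h n j) \<le> (\<Sum>i\<le>n. ces \<alpha> i j * cmod (g i))"
      unfolding h_def
      by (rule order_trans[OF norm_sum]) (simp add: norm_mult ces_nonneg[OF \<alpha>0])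
    also have "\<dots> \<le> (\<Sum>i. ces \<alpha> i j * cmod (g i))"
      by (rule sum_le_suminf[OF s]) (auto simp: ces_nonneg[OF \<alpha>0])
    also have "\<dots> \<le> cmod (of_real (\<Sum>i. ces \<alpha> i j * cmod (g i)))" by simp
    also have "complex_of_real (\<Sum>i. ces \<alpha> i j * cmod (g i)) = ces_transpose \<alpha> G j"
      using suminf_of_real[OF s, where 'a = complex] by (simp add: ces_transpose_def G_def)
    finally show ?thesis .
  qed
  define a where "a j n = (if j \<le> n then f j * cnj (h n j) else 0)" for j n
  have lim: "(\<lambda>n. a j n) \<longlonglongrightarrow> f j * cnj (ces_transpose \<alpha> g j)" for j
  proof (rule Lim_transform_eventually)
    show "(\<lambda>n. f j * cnj (h n j)) \<longlonglongrightarrow> f j * cnj (ces_transpose \<alpha> g j)"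
      unfolding h_def by (intro tendsto_intros ces_transpose_LIMSEQ \<alpha>0 g)
    show "\<forall>\<^sub>F n in sequentially. f j * cnj (h n j) = a j n"
      using eventually_ge_at_top[of j] by eventually_elim (simp add: a_def)
  qed
  have "cmod (a j n) \<le> cmod (f j) * cmod (ces_transpose \<alpha> G j)" for j n
    by (simp add: a_def norm_mult mult_left_mono[OF h_le])
  then have "\<forall>\<^sub>F (j, n) in sequentially \<times>\<^sub>F sequentially.
      cmod (a j n) \<le> cmod (f j) * cmod (ces_transpose \<alpha> G j)"
    by (intro always_eventually) auto
  then have "(\<lambda>n. \<Sum>j. a j n) \<longlonglongrightarrow> (\<Sum>j. f j * cnj (ces_transpose \<alpha> g j))"
    using tannerys_theorem[OF lim _ ell2_summable_mult[OF f ces_transpose_in_ell2[OF \<alpha> G]]]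
    by auto
  moreover have "(\<Sum>j. a j n) = (\<Sum>i\<le>n. ?M f i * cnj (g i))" for n
  proof -
    have "(\<Sum>j. a j n) = (\<Sum>j\<le>n. a j n)"
      by (rule suminf_finite) (auto simp: a_def)
    also have "\<dots> = (\<Sum>j\<le>n. \<Sum>i\<le>n. of_real (ces \<alpha> i j) * f j * cnj (g i))"
      by (simp add: a_def h_def sum_distrib_left mult_ac)
    also have "\<dots> = (\<Sum>i\<le>n. \<Sum>j\<le>n. of_real (ces \<alpha> i j) * f j * cnj (g i))"
      by (rule sum.swap)
    also have "\<dots> = (\<Sum>i\<le>n. \<Sum>j\<le>i. of_real (ces \<alpha> i j) * f j * cnj (g i))"
      by (intro sum.cong refl sum.mono_neutral_right) (auto simp: ces_def)
    also have "\<dots> = (\<Sum>i\<le>n. ?M f i * cnj (g i))"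
      by (simp add: matrix_op_cesaro2 sum_distrib_right)
    finally show ?thesis .
  qed
  moreover have "(\<lambda>n. \<Sum>i\<le>n. ?M f i * cnj (g i)) \<longlonglongrightarrow> ell2_inner (?M f) g"
    using ell2_inner_sums[OF Mf g] by (simp add: sums_def_le)
  ultimately show ?thesis
    unfolding ell2_inner_def[of f] by (simp add: LIMSEQ_unique)
qed

theorem corollary2p4:
  fixes \<alpha> :: real
  assumes "\<alpha> \<in> {0} \<union> {1..}"
  shows "hyponormal (matrix_op (cesaro2 \<alpha>))"
proof (rule hyponormalI)
  show "matrix_op (cesaro2 \<alpha>) \<in> bounded_ops"
    using assms by (intro matrix_op_cesaro2_bounded) auto
  show "ces_transpose \<alpha> g \<in> ell2" if "g \<in> ell2" for g
    by (rule ces_transpose_in_ell2[OF assms that])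
  show "ell2_inner (matrix_op (cesaro2 \<alpha>) f) g = ell2_inner f (ces_transpose \<alpha> g)"
    if "f \<in> ell2" "g \<in> ell2" for f g
    by (rule ces_transpose_adjoint[OF assms that])
  show "(\<Sum>n. (cmod (ces_transpose \<alpha> f n))\<^sup>2) \<le> (\<Sum>n. (cmod (matrix_op (cesaro2 \<alpha>) f n))\<^sup>2)"
    if "f \<in> ell2" for f
    using ces_transpose_in_ell2[OF assms that] ces_transpose_partial_sum_le[OF assms that]
    by (intro suminf_le_const) (auto simp: ell2_def)
qed

end
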